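(* Consider the table $\mathbb R^2\times[0,H]$, $H>0$, in $\mathbb R^3$ with the standard contact structure $\xi_{\mathrm{std}}$ and metric $g_{\mathrm{std}}$. $2$-bounce orbits in the table can be obtained as follows: Fix a positive integer $n$ and the radius $r_0=\sqrt{\frac{H}{\pi n}}$ (and an angle $\theta_0$). Then, there is a unique $2$-bounce trajectory $\gamma$ satisfying: - its reflection points are $(r_0,\theta_0,0)$ and $(r_0,\theta_0,H)$ in cylindrical coordinates; - both segments in between reflections are reversals of one another; - both segments lift a curve consisting of $n$ loops along the circle of radius $\rho=\frac{r_0}2$ and center $(r_0/2,\theta_0)$ (polar coordinates) in the plane.
   Context: On $\mathbb R^3$ with cylindrical coordinates $(r,\theta,z)$ let $\alpha=dz-\tfrac12(x\,dy-y\,dx)=dz-\tfrac12r^2d\theta$, $\xi_{\mathrm{std}}=\ker\alpha$, and $g_{\mathrm{std}}=dx^2+dy^2$ restricted to $\xi_{\mathrm{std}}$. Curves tangent to $\xi_{\mathrm{std}}$ are lifts of their projection to the $(x,y)$-plane, determined by it and an initial height via $\dot z=\frac12r^2\dot\theta$. Write covectors as $\lambda=a\alpha+b\,dx+c\,dy$; the dual norm is $\sqrt{b^2+c^2}$ and $S=\{b^2+c^2=1\}$. Geodesics parametrised by arclength are projections of Hamiltonian orbits of the dual norm in $S$; $a$ is constant along them, $(b,c)$ is the velocity of the planar projection, which is a circular arc of curvature $a$ (straight if $a=0$). A billiard trajectory in a table $W\subset\mathbb R^3$ is a curve in $W$, parametrised by arclength, consisting of geodesic segments between reflection points on $\partial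 W$, such that at each reflection point $q$ the ingoing and outgoing momenta $\lambda_{\rm in}\ne\lambda_{\rm out}\in S\cap T_q^*\mathbb R^3$ satisfy $\lambda_{\rm in}-\lambda_{\rm out}\in\mathrm{Ann}(T_q\partial W)$. A $2$-bounce orbit (trajectory) is a periodic billiard trajectory with two reflections per period.
   Formalization: The radius is taken as r_0 = 2·sqrt(H/(πn)) instead of sqrt(H/(πn)): n loops of radius r_0/2 rise by nπr_0²/4, which with the printed r_0 is H/4, not H, so no such trajectory exists; uniqueness is up to time translation. *)

theory Defs
  imports "HOL-Analysis.Analysis"
begin

section \<open>The standard contact structure on three-space\<close>

text \<open>Points, tangent vectors and covectors are all elements of \<open>real^3\<close> in the coordinates
  \<open>(x, y, z)\<close>; a covector \<open>p\<close> acts on a tangent vector \<open>v\<close> by \<open>p \<bullet> v\<close>.\<close>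

definition dx_form :: "real^3" where "dx_form = vector [1, 0, 0]"
definition dy_form :: "real^3" where "dy_form = vector [0, 1, 0]"
definition dz_form :: "real^3" where "dz_form = vector [0, 0, 1]"

definition contact_form :: "real^3 \<Rightarrow> real^3" where
  "contact_form q = dz_form - (1/2) *\<^sub>R (q$1 *\<^sub>R dy_form - q$2 *\<^sub>R dx_form)"

definition contact_plane :: "real^3 \<Rightarrow> (real^3) set" where
  "contact_plane q = {v. contact_form q \<bullet> v = 0}"

text \<open>The coefficients in \<open>p = a \<alpha> + b dx + c dy\<close>; see \<open>covector_decomposition\<close> below.\<close>

definition coef_a :: "real^3 \<Rightarrow> real^3 \<Rightarrow> real" where "coef_a q p = p$3"
definition coef_b :: "real^3 \<Rightarrow> real^3 \<Rightarrow> real" where "coef_b q p = p$1 - p$3 * q$2 / 2"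
definition coef_c :: "real^3 \<Rightarrow> real^3 \<Rightarrow> real" where "coef_c q p = p$2 + p$3 * q$1 / 2"

lemma covector_decomposition:
  "p = a *\<^sub>R contact_form q + b *\<^sub>R dx_form + c *\<^sub>R dy_form \<longleftrightarrow>
     a = coef_a q p \<and> b = coef_b q p \<and> c = coef_c q p"
  by (auto simp: vec_eq_iff forall_3 contact_form_def dx_form_def dy_form_def dz_form_def
      coef_a_def coef_b_def coef_c_def field_simps)

lemma contact_plane_iff:
  "v \<in> contact_plane q \<longleftrightarrow> v$3 = (q$1 * v$2 - q$2 * v$1) / 2"
  by (auto simp: contact_plane_def contact_form_def dx_form_def dy_form_def dz_form_def
      inner_vec_def sum_3 field_simps)

text \<open>The norm on covectors dual to \<open>dx\<^sup>2 + dy\<^sup>2\<close> on the contact plane.\<close>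

definition dual_norm :: "real^3 \<Rightarrow> real^3 \<Rightarrow> real" where
  "dual_norm q p = sqrt ((coef_b q p)\<^sup>2 + (coef_c q p)\<^sup>2)"


section \<open>Geodesics\<close>

text \<open>Hamilton's equations \<open>q' = \<partial>h/\<partial>p\<close>, \<open>p' = -\<partial>h/\<partial>q\<close> on a time set, with one-sided derivatives
  at its end points.\<close>

definition hamiltonian_orbit ::
    "(real^3 \<Rightarrow> real^3 \<Rightarrow> real) \<Rightarrow> (real \<Rightarrow> real^3) \<Rightarrow> (real \<Rightarrow> real^3) \<Rightarrow> real set \<Rightarrow> bool" where
  "hamiltonian_orbit h q p I \<longleftrightarrow>
     (\<forall>t\<in>I. \<exists>hp hq.
        GDERIV (\<lambda>p'. h (q t) p') (p t) :> hp \<and>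
        GDERIV (\<lambda>q'. h q' (p t)) (q t) :> hq \<and>
        (q has_vector_derivative hp) (at t within I) \<and>
        (p has_vector_derivative - hq) (at t within I))"

definition geodesic_momentum ::
    "(real \<Rightarrow> real^3) \<Rightarrow> (real \<Rightarrow> real^3) \<Rightarrow> real set \<Rightarrow> bool" where
  "geodesic_momentum \<gamma> p I \<longleftrightarrow>
     hamiltonian_orbit dual_norm \<gamma> p I \<and> (\<forall>t\<in>I. dual_norm (\<gamma> t) (p t) = 1)"

text \<open>Being projected from the unit level of the dual norm, such a curve is automatically
  parametrised by arclength.\<close>

definition geodesic_on :: "(real \<Rightarrow> real^3) \<Rightarrow> real set \<Rightarrow> bool" where
  "geodesic_on \<gamma> I \<longleftrightarrow> (\<exists>p. geodesic_momentum \<gamma> p I)"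


section \<open>Billiard trajectories\<close>

definition ingoing_momentum :: "(real \<Rightarrow> real^3) \<Rightarrow> real \<Rightarrow> real^3 \<Rightarrow> bool" where
  "ingoing_momentum \<gamma> t l \<longleftrightarrow> (\<exists>s p. s < t \<and> geodesic_momentum \<gamma> p {s..t} \<and> p t = l)"

definition outgoing_momentum :: "(real \<Rightarrow> real^3) \<Rightarrow> real \<Rightarrow> real^3 \<Rightarrow> bool" where
  "outgoing_momentum \<gamma> t l \<longleftrightarrow> (\<exists>u p. t < u \<and> geodesic_momentum \<gamma> p {t..u} \<and> p t = l)"

text \<open>The tangent space to \<open>\<partial>W\<close> at \<open>q\<close>, as velocities of curves in \<open>\<partial>W\<close>.\<close>

definition boundary_tangent :: "(real^3) set \<Rightarrow> real^3 \<Rightarrow> (real^3) set" where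
  "boundary_tangent W q =
     {v. \<exists>c. range c \<subseteq> frontier W \<and> c 0 = q \<and> (c has_vector_derivative v) (at (0::real))}"

definition annihilator :: "(real^3) set \<Rightarrow> (real^3) set" where
  "annihilator V = {l. \<forall>v\<in>V. l \<bullet> v = 0}"

text \<open>\<open>B\<close> is the set of reflection times.\<close>

definition billiard_trajectory :: "(real^3) set \<Rightarrow> (real \<Rightarrow> real^3) \<Rightarrow> real set \<Rightarrow> bool" where
  "billiard_trajectory W \<gamma> B \<longleftrightarrow>
     (\<forall>t. \<gamma> t \<in> W) \<and>
     (\<forall>s t. finite (B \<inter> {s..t})) \<and>
     (\<forall>s t. s < t \<longrightarrow> {s<..<t} \<inter> B = {} \<longrightarrow> geodesic_on \<gamma> {s..t}) \<and>
     (\<forall>t\<in>B. \<gamma> t \<in> frontier W \<and>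
        (\<exists>l_in l_out. ingoing_momentum \<gamma> t l_in \<and> outgoing_momentum \<gamma> t l_out \<and>
           l_in \<noteq> l_out \<and> l_in - l_out \<in> annihilator (boundary_tangent W (\<gamma> t))))"

text \<open>A periodic trajectory with period \<open>\<tau>\<close> whose reflections during one period, starting at \<open>t1\<close>,
  take place exactly at the times \<open>t1 < t2\<close>.\<close>

definition two_bounce_orbit ::
    "(real^3) set \<Rightarrow> (real \<Rightarrow> real^3) \<Rightarrow> real \<Rightarrow> real \<Rightarrow> real \<Rightarrow> bool" where
  "two_bounce_orbit W \<gamma> \<tau> t1 t2 \<longleftrightarrow>
     t1 < t2 \<and> t2 < t1 + \<tau> \<and> (\<forall>t. \<gamma> (t + \<tau>) = \<gamma> t) \<and>
     (\<exists>B. billiard_trajectory W \<gamma> B \<and> (\<forall>t. t + \<tau> \<in> B \<longleftrightarrow> t \<in> B) \<and>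
          B \<inter> {t1..<t1 + \<tau>} = {t1, t2})"


section \<open>The slab and the prescribed orbits\<close>

definition slab :: "real \<Rightarrow> (real^3) set" where
  "slab H = {q. 0 \<le> q$3 \<and> q$3 \<le> H}"

definition polar :: "real \<Rightarrow> real \<Rightarrow> real^2" where
  "polar r \<theta> = vector [r * cos \<theta>, r * sin \<theta>]"

definition cylindrical :: "real \<Rightarrow> real \<Rightarrow> real \<Rightarrow> real^3" where
  "cylindrical r \<theta> z = vector [r * cos \<theta>, r * sin \<theta>, z]"

definition plane_proj :: "real^3 \<Rightarrow> real^2" where
  "plane_proj q = vector [q$1, q$2]"

definition lifts_on :: "(real \<Rightarrow> real^3) \<Rightarrow> (real \<Rightarrow> real^2) \<Rightarrow> real set \<Rightarrow> bool" where
  "lifts_on \<gamma> c I \<longleftrightarrow>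
     (\<forall>t\<in>I. plane_proj (\<gamma> t) = c t \<and>
        (\<exists>v\<in>contact_plane (\<gamma> t). (\<gamma> has_vector_derivative v) (at t within I)))"

text \<open>The curve runs around the circle exactly \<open>n\<close> times, in either direction and without turning
  back, at arbitrary speed.\<close>

definition loops_along_circle ::
    "nat \<Rightarrow> real^2 \<Rightarrow> real \<Rightarrow> (real \<Rightarrow> real^2) \<Rightarrow> real \<Rightarrow> real \<Rightarrow> bool" where
  "loops_along_circle n ctr \<rho> c s t \<longleftrightarrow>
     (\<exists>\<phi>. continuous_on {s..t} \<phi> \<and>
        (strict_mono_on {s..t} \<phi> \<or> strict_antimono_on {s..t} \<phi>) \<and>
        \<bar>\<phi> t - \<phi> s\<bar> = 2 * pi * real n \<and>
        (\<forall>u\<in>{s..t}. c u = ctr + polar \<rho> (\<phi> u)))"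

definition reversed_segments ::
    "(real \<Rightarrow> 'a) \<Rightarrow> real \<Rightarrow> real \<Rightarrow> real \<Rightarrow> real \<Rightarrow> bool" where
  "reversed_segments \<gamma> s t s' t' \<longleftrightarrow>
     t - s = t' - s' \<and> (\<forall>u\<in>{0..t - s}. \<gamma> (s' + u) = \<gamma> (t - u))"

text \<open>The circle of radius \<open>r0/2\<close> about \<open>polar (r0/2) \<theta>0\<close> passes through the origin and through the
  common projection of both reflection points. A horizontal lift rises by the enclosed area
  \<open>\<pi> (r0/2)\<^sup>2\<close> per counterclockwise loop, so \<open>n\<close> loops reach height \<open>H\<close> only if
  \<open>n * \<pi> * r0\<^sup>2 = 4 * H\<close>. Reflection times are labelled so that \<open>t1\<close> is a bounce at the bottom.\<close>

definition circle_orbit :: "real \<Rightarrow> nat \<Rightarrow> real \<Rightarrow> real \<Rightarrow> (real \<Rightarrow> real^3) \<Rightarrow> bool" where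
  "circle_orbit H n r0 \<theta>0 \<gamma> \<longleftrightarrow>
     (\<exists>\<tau> t1 t2. two_bounce_orbit (slab H) \<gamma> \<tau> t1 t2 \<and>
        \<gamma> t1 = cylindrical r0 \<theta>0 0 \<and> \<gamma> t2 = cylindrical r0 \<theta>0 H \<and>
        reversed_segments \<gamma> t1 t2 t2 (t1 + \<tau>) \<and>
        (\<exists>c. loops_along_circle n (polar (r0/2) \<theta>0) (r0/2) c t1 t2 \<and> lifts_on \<gamma> c {t1..t2}) \<and>
        (\<exists>c. loops_along_circle n (polar (r0/2) \<theta>0) (r0/2) c t2 (t1 + \<tau>) \<and>
             lifts_on \<gamma> c {t2..t1 + \<tau>}))"

end

theory Submission
  imports Defs
begin

text \<open>On the unit level of the dual norm, \<open>p\<^sub>3 = a\<close> is constant and the planar velocity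
  \<open>(b, c)\<close> rotates with angular speed \<open>a\<close>. Differentiating the equation of the circle of radius
  \<open>\<rho> = r0/2\<close> twice along a geodesic above it forces \<open>a = \<plusminus>1/\<rho>\<close>, so the geodesic is an explicit lift,
  whose height after turning by an angle \<open>w\<close> is \<open>\<rho>\<^sup>2 (w + sin w) / 2\<close>. Since \<open>w + sin w\<close> is strictly
  increasing and \<open>H = n \<pi> \<rho>\<^sup>2\<close>, the top is reached exactly at \<open>w = 2 \<pi> n\<close>; reversal and periodicity
  then determine the whole orbit. Conversely, at the points above \<open>(r0, \<theta>0)\<close> the momentum of this
  lift is \<open>(0, 0, 1/\<rho>)\<close>, so reversing the lift changes the momentum by a multiple of \<open>dz\<close> only, which
  is the reflection law.\<close>

section \<open>Hamilton's equations in coordinates\<close>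

lemma has_vector_derivative_vec3_iff:
  fixes f :: "real \<Rightarrow> real^3"
  shows "(f has_vector_derivative v) F \<longleftrightarrow>
    ((\<lambda>t. f t $ 1) has_vector_derivative v$1) F \<and>
    ((\<lambda>t. f t $ 2) has_vector_derivative v$2) F \<and>
    ((\<lambda>t. f t $ 3) has_vector_derivative v$3) F"
proof (intro iffI conjI)
  assume c: "((\<lambda>t. f t $ 1) has_vector_derivative v$1) F \<and>
    ((\<lambda>t. f t $ 2) has_vector_derivative v$2) F \<and>
    ((\<lambda>t. f t $ 3) has_vector_derivative v$3) F"
  \<comment> \<open>The backward direction rebuilds \<open>f\<close> from its coordinates along the
    axis vectors, so that linearity of the derivative applies.\<close>
  define e :: "3 \<Rightarrow> real^3" where "e i = axis i 1" for i
  have expand: "w = w$1 *\<^sub>R e 1 + w$2 *\<^sub>R e 2 + w$3 *\<^sub>R e 3" for w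
    by (simp add: vec_eq_iff forall_3 axis_def e_def)
  have "((\<lambda>t. f t $ 1 *\<^sub>R e 1 + f t $ 2 *\<^sub>R e 2 + f t $ 3 *\<^sub>R e 3)
      has_vector_derivative v$1 *\<^sub>R e 1 + v$2 *\<^sub>R e 2 + v$3 *\<^sub>R e 3) F"
    using c by (intro has_vector_derivative_add
        bounded_linear.has_vector_derivative[OF bounded_linear_scaleR_left]) auto
  then show "(f has_vector_derivative v) F"
    by (simp flip: expand)
qed (auto intro: bounded_linear.has_vector_derivative[OF bounded_linear_vec_nth])

lemma dual_norm_eq_1_iff: "dual_norm q p = 1 \<longleftrightarrow> (coef_b q p)\<^sup>2 + (coef_c q p)\<^sup>2 = 1"
  by (simp add: dual_norm_def)

text \<open>On the unit level the radicand is 1, so the square root is differentiable and its factor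
  \<open>1 / dual_norm q p\<close> disappears. The gradient is the planar velocity
  \<open>(b, c)\<close>, completed to a vector of the contact plane.\<close>

lemma dual_norm_gderiv_momentum:
  assumes "dual_norm q p = 1"
  shows "GDERIV (\<lambda>p'. dual_norm q p') p :>
    vector [coef_b q p, coef_c q p, (q$1 * coef_c q p - q$2 * coef_b q p) / 2]"
  using assms unfolding dual_norm_eq_1_iff
  unfolding gderiv_def dual_norm_def coef_b_def coef_c_def
  by (auto intro!: derivative_eq_intros bounded_linear.has_derivative[OF bounded_linear_vec_nth]
      simp: inner_vec_def sum_3 algebra_simps fun_eq_iff add_divide_distrib diff_divide_distrib)

text \<open>The last entry vanishes because the dual norm is invariant under translation in z; this
  is what makes \<open>p$3\<close> a conserved quantity.\<close>

lemma dual_norm_gderiv_position: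
  assumes "dual_norm q p = 1"
  shows "GDERIV (\<lambda>q'. dual_norm q' p) q :>
    vector [p$3 * coef_c q p / 2, - (p$3 * coef_b q p / 2), 0]"
  using assms unfolding dual_norm_eq_1_iff
  unfolding gderiv_def dual_norm_def coef_b_def coef_c_def
  by (auto intro!: derivative_eq_intros bounded_linear.has_derivative[OF bounded_linear_vec_nth]
      simp: inner_vec_def sum_3 algebra_simps fun_eq_iff add_divide_distrib diff_divide_distrib)

lemma gderiv_unique:
  assumes "GDERIV f x :> d" "GDERIV f x :> e"
  shows "d = e"
proof -
  have "(\<lambda>h. h \<bullet> d) = (\<lambda>h. h \<bullet> e)"
    using assms unfolding gderiv_def by (rule has_derivative_unique)
  then show ?thesis
    by (metis inner_commute vector_eq_ldot)
qed

text \<open>Gradients are unique, so the existentially quantified \<open>hp\<close> and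
  \<open>hq\<close> of \<open>hamiltonian_orbit\<close> can be replaced by the explicit
  ones.\<close>

lemma geodesic_momentum_iff:
  "geodesic_momentum \<gamma> p I \<longleftrightarrow> (\<forall>t\<in>I. dual_norm (\<gamma> t) (p t) = 1 \<and>
     (\<gamma> has_vector_derivative
        vector [coef_b (\<gamma> t) (p t), coef_c (\<gamma> t) (p t),
          (\<gamma> t$1 * coef_c (\<gamma> t) (p t) - \<gamma> t$2 * coef_b (\<gamma> t) (p t)) / 2]) (at t within I) \<and>
     (p has_vector_derivative
        - vector [p t$3 * coef_c (\<gamma> t) (p t) / 2, - (p t$3 * coef_b (\<gamma> t) (p t) / 2), 0])
          (at t within I))"
proof -
  have "(\<exists>hp hq. GDERIV (\<lambda>p'. dual_norm (\<gamma> t) p') (p t) :> hp \<and>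
        GDERIV (\<lambda>q'. dual_norm q' (p t)) (\<gamma> t) :> hq \<and>
        (\<gamma> has_vector_derivative hp) (at t within I) \<and>
        (p has_vector_derivative - hq) (at t within I)) \<longleftrightarrow>
     (\<gamma> has_vector_derivative
        vector [coef_b (\<gamma> t) (p t), coef_c (\<gamma> t) (p t),
          (\<gamma> t$1 * coef_c (\<gamma> t) (p t) - \<gamma> t$2 * coef_b (\<gamma> t) (p t)) / 2]) (at t within I) \<and>
     (p has_vector_derivative
        - vector [p t$3 * coef_c (\<gamma> t) (p t) / 2, - (p t$3 * coef_b (\<gamma> t) (p t) / 2), 0])
          (at t within I)" (is "?L \<longleftrightarrow> ?R") if "dual_norm (\<gamma> t) (p t) = 1" for t
  proof
    show "?R" if ?L
      using that gderiv_unique[OF dual_norm_gderiv_momentum[OF \<open>dual_norm (\<gamma> t) (p t) = 1\<close>]]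
        gderiv_unique[OF dual_norm_gderiv_position[OF \<open>dual_norm (\<gamma> t) (p t) = 1\<close>]]
      by blast
    show "?L" if ?R
      using that dual_norm_gderiv_momentum[OF \<open>dual_norm (\<gamma> t) (p t) = 1\<close>]
        dual_norm_gderiv_position[OF \<open>dual_norm (\<gamma> t) (p t) = 1\<close>] by blast
  qed
  then show ?thesis
    unfolding geodesic_momentum_def hamiltonian_orbit_def by (auto simp: Ball_def)
qed

lemma geodesic_momentum_iff_coordinates:
  "geodesic_momentum \<gamma> p I \<longleftrightarrow>
   (\<forall>t\<in>I. let b = coef_b (\<gamma> t) (p t); c = coef_c (\<gamma> t) (p t) in
      b\<^sup>2 + c\<^sup>2 = 1 \<and>
      ((\<lambda>t. \<gamma> t$1) has_real_derivative b) (at t within I) \<and>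
      ((\<lambda>t. \<gamma> t$2) has_real_derivative c) (at t within I) \<and>
      ((\<lambda>t. \<gamma> t$3) has_real_derivative (\<gamma> t$1 * c - \<gamma> t$2 * b) / 2) (at t within I) \<and>
      ((\<lambda>t. p t$1) has_real_derivative - (p t$3 * c / 2)) (at t within I) \<and>
      ((\<lambda>t. p t$2) has_real_derivative p t$3 * b / 2) (at t within I) \<and>
      ((\<lambda>t. p t$3) has_real_derivative 0) (at t within I))"
  unfolding geodesic_momentum_iff has_vector_derivative_vec3_iff dual_norm_eq_1_iff Let_def
    has_real_derivative_iff_has_vector_derivative
  by simp

lemma geodesic_momentum_subset:
  assumes "geodesic_momentum \<gamma> p I" "J \<subseteq> I"
  shows "geodesic_momentum \<gamma> p J"
  using assms unfolding geodesic_momentum_iff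
  by (meson has_vector_derivative_within_subset subsetD)

lemma geodesic_momentum_cong:
  assumes "geodesic_momentum \<gamma> p I" "\<And>t. t \<in> I \<Longrightarrow> \<gamma>' t = \<gamma> t"
  shows "geodesic_momentum \<gamma>' p I"
  using assms unfolding geodesic_momentum_iff
  by (auto intro: has_vector_derivative_transform)

text \<open>The velocity in \<open>geodesic_momentum_iff\<close> satisfies
  \<open>contact_plane_iff\<close> by its very form.\<close>

lemma geodesic_momentum_lifts_on:
  assumes "geodesic_momentum \<gamma> p I" "\<And>t. t \<in> I \<Longrightarrow> plane_proj (\<gamma> t) = c t"
  shows "lifts_on \<gamma> c I"
  using assms unfolding geodesic_momentum_iff lifts_on_def
  by (force simp: contact_plane_iff)

section \<open>Lifts of the circle\<close>

text \<open>The parameter \<open>u\<close> is planar arclength, measured from the point of the circle opposite to the origin.\<close>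

definition lift :: "real \<Rightarrow> real \<Rightarrow> real \<Rightarrow> real^3" where
  "lift \<rho> \<theta> u = vector [\<rho> * (cos \<theta> + cos (\<theta> + u / \<rho>)), \<rho> * (sin \<theta> + sin (\<theta> + u / \<rho>)),
     \<rho>\<^sup>2 * (u / \<rho> + sin (u / \<rho>)) / 2]"

text \<open>The solution of \<open>coef_a = 1 / \<rho>\<close> and \<open>(coef_b, coef_c) = (- sin
  (\<theta> + u / \<rho>), cos (\<theta> + u / \<rho>))\<close> at the point
  \<open>lift \<rho> \<theta> u\<close>: curvature and unit tangent of the counterclockwise
  circle.\<close>

definition lift_momentum :: "real \<Rightarrow> real \<Rightarrow> real \<Rightarrow> real^3" where
  "lift_momentum \<rho> \<theta> u = vector [(sin \<theta> - sin (\<theta> + u / \<rho>)) / 2,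
     (cos (\<theta> + u / \<rho>) - cos \<theta>) / 2, 1 / \<rho>]"

text \<open>The dual norm is even in the momentum, so negating the momentum reverses a geodesic;
  \<open>\<sigma> = -1\<close> is the lift run backwards. The offset \<open>s\<close> is the time at
  which \<open>u = 0\<close>.\<close>

lemma geodesic_momentum_lift:
  assumes "\<rho> > 0" and \<sigma>: "\<sigma> = 1 \<or> \<sigma> = -1"
  shows "geodesic_momentum (\<lambda>t. lift \<rho> \<theta> (\<sigma> * (t - s)))
    (\<lambda>t. \<sigma> *\<^sub>R lift_momentum \<rho> \<theta> (\<sigma> * (t - s))) I"
proof -
  define \<psi> where "\<psi> t = \<theta> + \<sigma> * (t - s) / \<rho>" for t
  have b: "coef_b (lift \<rho> \<theta> (\<sigma> * (t - s))) (\<sigma> *\<^sub>R lift_momentum \<rho> \<theta> (\<sigma> * (t - s))) = - \<sigma> * sin (\<psi> t)" for t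
    using \<open>\<rho> > 0\<close> by (simp add: coef_b_def lift_def lift_momentum_def \<psi>_def field_simps)
  have c: "coef_c (lift \<rho> \<theta> (\<sigma> * (t - s))) (\<sigma> *\<^sub>R lift_momentum \<rho> \<theta> (\<sigma> * (t - s))) = \<sigma> * cos (\<psi> t)" for t
    using \<open>\<rho> > 0\<close> by (simp add: coef_c_def lift_def lift_momentum_def \<psi>_def field_simps)
  \<comment> \<open>The horizontality condition for the height, rewritten with the cosine of the
    turning angle so that it matches the derivative of \<open>w + sin w\<close>.\<close>
  have z: "(\<rho> * (cos \<theta> + cos (\<psi> t)) * (\<sigma> * cos (\<psi> t)) -
      \<rho> * (sin \<theta> + sin (\<psi> t)) * (- \<sigma> * sin (\<psi> t))) / 2 =
      \<rho> * \<sigma> * (cos (\<sigma> * (t - s) / \<rho>) + 1) / 2" for t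
  proof -
    have "cos (\<sigma> * (t - s) / \<rho>) = cos \<theta> * cos (\<psi> t) + sin \<theta> * sin (\<psi> t)"
      using cos_diff[of "\<psi> t" \<theta>] by (simp add: \<psi>_def algebra_simps)
    then have "\<rho> * (cos \<theta> + cos (\<psi> t)) * (\<sigma> * cos (\<psi> t)) -
        \<rho> * (sin \<theta> + sin (\<psi> t)) * (- \<sigma> * sin (\<psi> t)) =
        \<rho> * \<sigma> * (cos (\<sigma> * (t - s) / \<rho>) + 1)"
      using sin_cos_squared_add[of "\<psi> t"] by algebra
    then show ?thesis by simp
  qed
  have components:
    "lift \<rho> \<theta> (\<sigma> * (t - s)) $ 1 = \<rho> * (cos \<theta> + cos (\<psi> t))"
    "lift \<rho> \<theta> (\<sigma> * (t - s)) $ 2 = \<rho> * (sin \<theta> + sin (\<psi> t))"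
    "lift \<rho> \<theta> (\<sigma> * (t - s)) $ 3 = \<rho>\<^sup>2 * (\<sigma> * (t - s) / \<rho> + sin (\<sigma> * (t - s) / \<rho>)) / 2"
    "(\<sigma> *\<^sub>R lift_momentum \<rho> \<theta> (\<sigma> * (t - s))) $ 1 = \<sigma> * ((sin \<theta> - sin (\<psi> t)) / 2)"
    "(\<sigma> *\<^sub>R lift_momentum \<rho> \<theta> (\<sigma> * (t - s))) $ 2 = \<sigma> * ((cos (\<psi> t) - cos \<theta>) / 2)"
    "(\<sigma> *\<^sub>R lift_momentum \<rho> \<theta> (\<sigma> * (t - s))) $ 3 = \<sigma> / \<rho>" for t
    by (simp_all add: lift_def lift_momentum_def \<psi>_def)
  have \<psi>': "(\<psi> has_real_derivative \<sigma> / \<rho>) (at t within I)" for t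
    unfolding \<psi>_def using \<open>\<rho> > 0\<close> by (auto intro!: derivative_eq_intros)
  have "(\<sigma> * sin (\<psi> t))\<^sup>2 + (\<sigma> * cos (\<psi> t))\<^sup>2 = 1" for t
    using \<sigma> by auto
  moreover have "((\<lambda>t. \<rho> * (cos \<theta> + cos (\<psi> t))) has_real_derivative - (\<sigma> * sin (\<psi> t))) (at t within I)" for t
    using \<open>\<rho> > 0\<close> by (auto intro!: derivative_eq_intros \<psi>')
  moreover have "((\<lambda>t. \<rho> * (sin \<theta> + sin (\<psi> t))) has_real_derivative \<sigma> * cos (\<psi> t)) (at t within I)" for t
    using \<open>\<rho> > 0\<close> by (auto intro!: derivative_eq_intros \<psi>')
  moreover have "((\<lambda>t. \<rho>\<^sup>2 * (\<sigma> * (t - s) / \<rho> + sin (\<sigma> * (t - s) / \<rho>)) / 2) has_real_derivative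
      \<rho> * \<sigma> * (cos (\<sigma> * (t - s) / \<rho>) + 1) / 2) (at t within I)" for t
    using \<open>\<rho> > 0\<close> by (auto intro!: derivative_eq_intros simp: field_simps power2_eq_square)
  moreover have "((\<lambda>t. \<sigma> * ((sin \<theta> - sin (\<psi> t)) / 2)) has_real_derivative
      - (\<sigma> / \<rho> * (\<sigma> * cos (\<psi> t)) / 2)) (at t within I)" for t
    using \<open>\<rho> > 0\<close> by (auto intro!: derivative_eq_intros \<psi>')
  moreover have "((\<lambda>t. \<sigma> * ((cos (\<psi> t) - cos \<theta>) / 2)) has_real_derivative
      \<sigma> / \<rho> * - (\<sigma> * sin (\<psi> t)) / 2) (at t within I)" for t
    using \<open>\<rho> > 0\<close> by (auto intro!: derivative_eq_intros \<psi>')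
  ultimately show ?thesis
    unfolding geodesic_momentum_iff_coordinates Let_def b c components z
    by simp
qed

section \<open>Rigidity of geodesics above the circle\<close>

text \<open>One-sided derivatives at the end points are covered too, since derivatives within a
  nondegenerate closed interval are unique.\<close>

lemma constant_Icc_derivative_eq_0:
  fixes f :: "real \<Rightarrow> real"
  assumes "(f has_real_derivative d) (at x within {s..t})" "s < t" "x \<in> {s..t}"
    and "\<And>u. u \<in> {s..t} \<Longrightarrow> f u = k"
  shows "d = 0"
proof -
  have "(f has_vector_derivative 0) (at x within {s..t})"
    using assms by (intro has_vector_derivative_transform[OF _ _ has_vector_derivative_const[of k]]) auto
  then show ?thesis
    using assms vector_derivative_unique_within_closed_interval[of s t x f d 0]
    by (simp add: has_real_derivative_iff_has_vector_derivative)
qed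

lemma zero_derivative_Icc_constant:
  fixes f :: "real \<Rightarrow> real"
  assumes "\<And>x. x \<in> {s..t} \<Longrightarrow> (f has_real_derivative 0) (at x within {s..t})"
    and "u \<in> {s..t}"
  shows "f u = f s"
  using has_field_derivative_zero_constant[of "{s..t}" f] assms by fastforce

text \<open>Once the curvature \<open>a\<close> is known, the equations are integrated by exhibiting
  quantities of derivative zero: the position about the centre in a frame rotating with speed
  \<open>a\<close>, then the height. This takes the place of a uniqueness theorem for differential
  equations.\<close>

lemma geodesic_on_circle_eq_lift:
  assumes geo: "geodesic_on \<gamma> {s..t}" and "s < t" and "\<rho> > 0"
    and circle: "\<And>u. u \<in> {s..t} \<Longrightarrow>
      (\<gamma> u $ 1 - \<rho> * cos \<theta>)\<^sup>2 + (\<gamma> u $ 2 - \<rho> * sin \<theta>)\<^sup>2 = \<rho>\<^sup>2"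
    and start: "\<gamma> s = cylindrical (2 * \<rho>) \<theta> 0"
  obtains \<sigma> where "\<sigma> = 1 \<or> \<sigma> = -1" "\<And>u. u \<in> {s..t} \<Longrightarrow> \<gamma> u = lift \<rho> \<theta> (\<sigma> * (u - s))"
proof -
  let ?I = "{s..t}"
  from geo obtain p where p: "geodesic_momentum \<gamma> p ?I"
    unfolding geodesic_on_def by blast
  \<comment> \<open>\<open>(x, y)\<close> is the planar position relative to the centre of the
    circle, \<open>(b, c)\<close> the planar velocity.\<close>
  define x y b c a where "x u = \<gamma> u $ 1 - \<rho> * cos \<theta>" and "y u = \<gamma> u $ 2 - \<rho> * sin \<theta>"
    and "b u = coef_b (\<gamma> u) (p u)" and "c u = coef_c (\<gamma> u) (p u)" and "a = p s $ 3" for u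
  have D: "(b u)\<^sup>2 + (c u)\<^sup>2 = 1"
      "((\<lambda>t. \<gamma> t$1) has_real_derivative b u) (at u within ?I)"
      "((\<lambda>t. \<gamma> t$2) has_real_derivative c u) (at u within ?I)"
      "((\<lambda>t. \<gamma> t$3) has_real_derivative (\<gamma> u$1 * c u - \<gamma> u$2 * b u) / 2) (at u within ?I)"
      "((\<lambda>t. p t$1) has_real_derivative - (p u$3 * c u / 2)) (at u within ?I)"
      "((\<lambda>t. p t$2) has_real_derivative p u$3 * b u / 2) (at u within ?I)"
      "((\<lambda>t. p t$3) has_real_derivative 0) (at u within ?I)" if "u \<in> ?I" for u
    using p that unfolding geodesic_momentum_iff_coordinates Let_def b_def c_def by blast+
  have a: "p u $ 3 = a" if "u \<in> ?I" for u
    using zero_derivative_Icc_constant[of s t "\<lambda>u. p u $ 3" u] D(7) that by (simp add: a_def)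
  have x': "(x has_real_derivative b u) (at u within ?I)"
    and y': "(y has_real_derivative c u) (at u within ?I)" if "u \<in> ?I" for u
    unfolding x_def y_def using D(2,3)[OF that] by (auto intro!: derivative_eq_intros)
  have b': "(b has_real_derivative - (a * c u)) (at u within ?I)"
    and c': "(c has_real_derivative a * b u) (at u within ?I)" if "u \<in> ?I" for u
  proof -
    note [derivative_intros] = D[OF that]
    \<comment> \<open>Half of the rotation comes from the momentum coordinate, half from the
      position in the second summand; \<open>p u $ 3\<close> itself has derivative zero.\<close>
    have "((\<lambda>u. p u $ 1 - p u $ 3 * \<gamma> u $ 2 / 2) has_real_derivative - (p u $ 3 * c u)) (at u within ?I)"
      and "((\<lambda>u. p u $ 2 + p u $ 3 * \<gamma> u $ 1 / 2) has_real_derivative p u $ 3 * b u) (at u within ?I)"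
      by (auto intro!: derivative_eq_intros)
    then show "(b has_real_derivative - (a * c u)) (at u within ?I)"
      and "(c has_real_derivative a * b u) (at u within ?I)"
      unfolding b_def[abs_def] c_def[abs_def] coef_b_def[symmetric] coef_c_def[symmetric]
      by (simp_all add: a[OF that])
  qed
  have eq: "x u * x u + y u * y u = \<rho>\<^sup>2" if "u \<in> ?I" for u
    using circle[OF that] by (simp add: x_def y_def power2_eq_square)
  have orth: "x u * b u + y u * c u = 0" if "u \<in> ?I" for u
  proof -
    have "((\<lambda>u. x u * x u + y u * y u) has_real_derivative 2 * (x u * b u + y u * c u)) (at u within ?I)"
      by (auto intro!: derivative_eq_intros x'[OF that] y'[OF that])
    then have "2 * (x u * b u + y u * c u) = 0"
      using constant_Icc_derivative_eq_0 \<open>s < t\<close> that eq by blast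
    then show ?thesis by simp
  qed
  have curv: "a * (x u * c u - y u * b u) = 1" if "u \<in> ?I" for u
  proof -
    \<comment> \<open>The second differentiation: the acceleration is \<open>a\<close> times the
      velocity turned by a right angle.\<close>
    have "((\<lambda>u. x u * b u + y u * c u) has_real_derivative
        (b u)\<^sup>2 + (c u)\<^sup>2 - a * (x u * c u - y u * b u)) (at u within ?I)"
      by (auto intro!: derivative_eq_intros x'[OF that] y'[OF that] b'[OF that] c'[OF that]
          simp: power2_eq_square algebra_simps)
    then have "(b u)\<^sup>2 + (c u)\<^sup>2 - a * (x u * c u - y u * b u) = 0"
      using constant_Icc_derivative_eq_0 \<open>s < t\<close> that orth by blast
    then show ?thesis using D(1)[OF that] by simp
  qed
  have bc: "b u = - (a * y u)" "c u = a * x u" if "u \<in> ?I" for u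
  proof -
    \<comment> \<open>As \<open>(x, y)\<close> is orthogonal to the unit vector
      \<open>(b, c)\<close>, it is a multiple of \<open>(c, -b)\<close>; multiplying by
      \<open>a\<close> and using \<open>curv\<close> removes the unknown factor.\<close>
    have "x u = c u * (x u * c u - y u * b u)" "y u = - (b u * (x u * c u - y u * b u))"
      using orth[OF that] D(1)[OF that] by algebra+
    then show "b u = - (a * y u)" "c u = a * x u"
      using curv[OF that] by algebra+
  qed
  have s: "s \<in> ?I" using \<open>s < t\<close> by simp
  \<comment> \<open>Unit speed \<open>b\<^sup>2 + c\<^sup>2 = 1\<close> becomes
    \<open>a\<^sup>2 * (x\<^sup>2 + y\<^sup>2) = 1\<close> through \<open>bc\<close>.\<close>
  have "(a * \<rho>)\<^sup>2 = 1"
    using bc[OF s] eq[OF s] D(1)[OF s] by algebra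
  then have a\<rho>: "a * \<rho> = 1 \<or> a * \<rho> = -1"
    by (simp add: power2_eq_1_iff)
  have start': "x s = \<rho> * cos \<theta>" "y s = \<rho> * sin \<theta>" "\<gamma> s $ 3 = 0"
    using start by (simp_all add: x_def y_def cylindrical_def)
  define \<psi> where "\<psi> u = \<theta> + a * (u - s)" for u
  have \<psi>s: "\<psi> s = \<theta>"
    by (simp add: \<psi>_def)
  have \<psi>': "(\<psi> has_real_derivative a) (at u within ?I)" for u
    unfolding \<psi>_def by (auto intro!: derivative_eq_intros)
  \<comment> \<open>Scalar and cross product of \<open>(x, y)\<close> with
    \<open>(cos \<psi>, sin \<psi>)\<close> are constant, since by \<open>bc\<close> both vectors
    rotate with angular speed \<open>a\<close>. Their initial values are \<rho> and 0.\<close>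
  have "x u * cos (\<psi> u) + y u * sin (\<psi> u) = x s * cos (\<psi> s) + y s * sin (\<psi> s)" if "u \<in> ?I" for u
    using that
    by (intro zero_derivative_Icc_constant[where f = "\<lambda>u. x u * cos (\<psi> u) + y u * sin (\<psi> u)" and t=t])
      (auto intro!: derivative_eq_intros x' y' \<psi>' simp: bc algebra_simps)
  moreover have "x s * cos (\<psi> s) + y s * sin (\<psi> s) = \<rho>"
    using sin_cos_squared_add[of \<theta>] unfolding start' \<psi>s by algebra
  ultimately have 1: "x u * cos (\<psi> u) + y u * sin (\<psi> u) = \<rho>" if "u \<in> ?I" for u
    using that by simp
  have "y u * cos (\<psi> u) - x u * sin (\<psi> u) = y s * cos (\<psi> s) - x s * sin (\<psi> s)" if "u \<in> ?I" for u
    using that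
    by (intro zero_derivative_Icc_constant[where f = "\<lambda>u. y u * cos (\<psi> u) - x u * sin (\<psi> u)" and t=t])
      (auto intro!: derivative_eq_intros x' y' \<psi>' simp: bc algebra_simps)
  then have 2: "y u * cos (\<psi> u) - x u * sin (\<psi> u) = 0" if "u \<in> ?I" for u
    using that unfolding start' \<psi>s by simp
  have xy: "x u = \<rho> * cos (\<psi> u)" "y u = \<rho> * sin (\<psi> u)" if "u \<in> ?I" for u
  proof -
    \<comment> \<open>Rotating back out of the moving frame.\<close>
    have "x u = (x u * cos (\<psi> u) + y u * sin (\<psi> u)) * cos (\<psi> u) -
          (y u * cos (\<psi> u) - x u * sin (\<psi> u)) * sin (\<psi> u)"
      and "y u = (x u * cos (\<psi> u) + y u * sin (\<psi> u)) * sin (\<psi> u) +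
          (y u * cos (\<psi> u) - x u * sin (\<psi> u)) * cos (\<psi> u)"
      using sin_cos_squared_add[of "\<psi> u"] by algebra+
    then show "x u = \<rho> * cos (\<psi> u)" "y u = \<rho> * sin (\<psi> u)"
      unfolding 1[OF that] 2[OF that] by simp_all
  qed
  have cos_diff_\<psi>: "cos (a * (u - s)) = cos \<theta> * cos (\<psi> u) + sin \<theta> * sin (\<psi> u)" for u
    using cos_diff[of "\<psi> u" \<theta>] by (simp add: \<psi>_def algebra_simps)
  \<comment> \<open>The claimed height has the derivative prescribed by the contact plane, so its
    difference from the actual height is constant.\<close>
  have z': "((\<lambda>u. \<gamma> u $ 3 - \<rho>\<^sup>2 * (a * (u - s) + sin (a * (u - s))) / 2) has_real_derivative 0)
      (at u within ?I)" if "u \<in> ?I" for u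
  proof -
    have "((\<lambda>u. \<gamma> u $ 3 - \<rho>\<^sup>2 * (a * (u - s) + sin (a * (u - s))) / 2) has_real_derivative
        (\<gamma> u$1 * c u - \<gamma> u$2 * b u) / 2 - \<rho>\<^sup>2 * (a + a * cos (a * (u - s))) / 2) (at u within ?I)"
      by (auto intro!: derivative_eq_intros D(4)[OF that])
    moreover have "\<gamma> u$1 = \<rho> * (cos \<theta> + cos (\<psi> u))" "\<gamma> u$2 = \<rho> * (sin \<theta> + sin (\<psi> u))"
      using xy[OF that] by (simp_all add: x_def y_def algebra_simps)
    then have "\<gamma> u$1 * c u - \<gamma> u$2 * b u = \<rho>\<^sup>2 * (a + a * cos (a * (u - s)))"
      unfolding cos_diff_\<psi> using bc[OF that] xy[OF that] sin_cos_squared_add[of "\<psi> u"] by algebra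
    ultimately show ?thesis by simp
  qed
  have z: "\<gamma> u $ 3 = \<rho>\<^sup>2 * (a * (u - s) + sin (a * (u - s))) / 2" if "u \<in> ?I" for u
    using zero_derivative_Icc_constant[OF z' that] start' by simp
  \<comment> \<open>The direction \<sigma> of the conclusion is \<open>a * \<rho>\<close>, the sign
    of the curvature.\<close>
  have "\<gamma> u = lift \<rho> \<theta> (a * \<rho> * (u - s))" if "u \<in> ?I" for u
  proof -
    have "lift \<rho> \<theta> (a * \<rho> * (u - s)) = vector [\<rho> * (cos \<theta> + cos (\<psi> u)),
        \<rho> * (sin \<theta> + sin (\<psi> u)), \<rho>\<^sup>2 * (a * (u - s) + sin (a * (u - s))) / 2]"
      using \<open>\<rho> > 0\<close> by (simp add: lift_def \<psi>_def)
    then show ?thesis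
      using xy[OF that] z[OF that]
      by (simp add: vec_eq_iff forall_3 x_def y_def distrib_left diff_eq_eq)
  qed
  with a\<rho> that show thesis by blast
qed

section \<open>The height as a function of the turning angle\<close>

text \<open>A root satisfies \<open>\<bar>x\<bar> \<le> 1 < pi\<close>, and in that range
  \<open>sin x\<close> has the sign of \<open>x\<close>, so the two terms cannot cancel.\<close>

lemma add_sin_eq_0_iff: "x + sin x = 0 \<longleftrightarrow> x = 0" for x :: real
proof
  assume "x + sin x = 0"
  moreover have "\<bar>sin x\<bar> \<le> 1" by simp
  ultimately have "\<bar>x\<bar> \<le> 1" by linarith
  then have "\<bar>x\<bar> < pi" using pi_gt3 by linarith
  then show "x = 0"
    using sin_gt_zero[of x] sin_gt_zero[of "-x"] \<open>x + sin x = 0\<close> by (cases x "0::real" rule: linorder_cases) auto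
qed simp

lemma mono_add_sin: "mono (\<lambda>x::real. x + sin x)"
proof (rule monoI)
  fix x y :: real
  assume "x \<le> y"
  then show "x + sin x \<le> y + sin y"
  proof (rule DERIV_nonneg_imp_nondecreasing)
    fix u :: real
    have "((\<lambda>x. x + sin x) has_real_derivative 1 + cos u) (at u)"
      by (auto intro!: derivative_eq_intros)
    moreover have "0 \<le> 1 + cos u" using cos_ge_minus_one[of u] by linarith
    ultimately show "\<exists>d. ((\<lambda>x. x + sin x) has_real_derivative d) (at u) \<and> 0 \<le> d" by blast
  qed
qed

text \<open>Shifting \<open>x\<close> by \<open>n\<close> full turns reduces this to
  \<open>add_sin_eq_0_iff\<close>. It recovers the turning angle from the height of the upper
  reflection point.\<close>

lemma add_sin_eq_iff: "x + sin x = 2 * pi * real n \<longleftrightarrow> x = 2 * pi * real n"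
proof -
  have "sin x = sin (x - 2 * pi * real n)"
    using sin.plus_of_nat[of "x - 2 * pi * real n" n] by (simp add: algebra_simps)
  then show ?thesis
    using add_sin_eq_0_iff[of "x - 2 * pi * real n"] by auto
qed

section \<open>Reflections in the slab\<close>

lemma closed_slab: "closed (slab H)"
proof -
  have "closed ({q::real^3. 0 \<le> q$3} \<inter> {q. q$3 \<le> H})"
    by (intro closed_Int closed_Collect_le continuous_intros)
  then show ?thesis
    by (simp add: slab_def Collect_conj_eq)
qed

lemma frontier_slab:
  assumes "H > 0"
  shows "frontier (slab H) = {q. q$3 = 0 \<or> q$3 = H}"
proof -
  have "{q. 0 < q$3 \<and> q$3 < H} \<subseteq> interior (slab H)"
  proof (rule interior_maximal)
    have "open ({q::real^3. 0 < q$3} \<inter> {q. q$3 < H})"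
      by (intro open_Int open_Collect_less continuous_intros)
    then show "open {q::real^3. 0 < q$3 \<and> q$3 < H}"
      by (simp add: Collect_conj_eq)
  qed (auto simp: slab_def)
  moreover have "q \<notin> interior (slab H)" if q: "q$3 = 0 \<or> q$3 = H" for q
  proof
    assume "q \<in> interior (slab H)"
    then obtain e where "e > 0" and e: "cball q e \<subseteq> slab H"
      by (meson mem_interior_cball)
    \<comment> \<open>Moving vertically by \<open>e\<close> up or down stays in the closed ball, but
      from a boundary height one of the two moves leaves the slab.\<close>
    have "q + c *\<^sub>R axis 3 1 \<in> slab H" if "\<bar>c\<bar> = e" for c
      using that by (intro subsetD[OF e]) (simp add: dist_norm)
    from this[of e] this[of "-e"] show False
      using q \<open>e > 0\<close> by (auto simp: slab_def axis_def)
  qed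
  ultimately have "q \<in> interior (slab H) \<longleftrightarrow> 0 < q$3 \<and> q$3 < H" if "q \<in> slab H" for q
    using that by (fastforce simp: slab_def)
  moreover have "frontier (slab H) = {q \<in> slab H. q \<notin> interior (slab H)}"
    using closed_slab[of H] by (auto simp: frontier_def)
  ultimately show ?thesis
    using assms by (auto simp: slab_def)
qed

text \<open>Along a curve in the boundary the height stays between 0 and \<open>H\<close> and is
  extremal at time 0, so its derivative there vanishes: boundary tangents have no
  z-component.\<close>

lemma vertical_in_annihilator_slab:
  assumes "H > 0" "q$3 = 0 \<or> q$3 = H" "l$1 = 0" "l$2 = 0"
  shows "l \<in> annihilator (boundary_tangent (slab H) q)"
  unfolding annihilator_def
proof (intro CollectI ballI)
  fix v assume "v \<in> boundary_tangent (slab H) q"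
  then obtain c where c: "range c \<subseteq> frontier (slab H)" "c 0 = q"
      "(c has_vector_derivative v) (at (0::real))"
    unfolding boundary_tangent_def by blast
  have d: "((\<lambda>t. c t $ 3) has_real_derivative v$3) (at 0)"
    using c(3) by (simp add: has_vector_derivative_vec3_iff has_real_derivative_iff_has_vector_derivative)
  have bounds: "0 \<le> c t $ 3" "c t $ 3 \<le> H" for t
    using c(1) \<open>H > 0\<close> by (auto simp: frontier_slab image_subset_iff dest!: spec[of _ t])
  have "v$3 = 0"
    using assms(2)
  proof
    assume "q$3 = 0"
    then show ?thesis
      using bounds c(2) by (intro DERIV_local_min[OF d zero_less_one]) auto
  next
    assume "q$3 = H"
    then show ?thesis
      using bounds c(2) by (intro DERIV_local_max[OF d zero_less_one]) auto
  qed
  then show "l \<bullet> v = 0"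
    using assms by (simp add: inner_vec_def sum_3)
qed

section \<open>The folded lift\<close>

lemma lift_0: "lift \<rho> \<theta> 0 = cylindrical (2 * \<rho>) \<theta> 0"
  by (simp add: lift_def cylindrical_def algebra_simps)

lemma angle_add_2pi_nat:
  "sin (\<theta> + 2 * pi * real n) = sin \<theta>" "cos (\<theta> + 2 * pi * real n) = cos \<theta>"
  using sin.plus_of_nat[of \<theta> n] cos.plus_of_nat[of \<theta> n] by (simp_all add: algebra_simps)

lemma lift_loops:
  assumes "\<rho> > 0"
  shows "lift \<rho> \<theta> (2 * pi * real n * \<rho>) = cylindrical (2 * \<rho>) \<theta> (real n * pi * \<rho>\<^sup>2)"
  using assms angle_add_2pi_nat(1)[of 0 n]
  by (simp add: lift_def cylindrical_def angle_add_2pi_nat) (simp add: algebra_simps)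

lemma lift_momentum_loops:
  assumes "\<rho> > 0"
  shows "lift_momentum \<rho> \<theta> (2 * pi * real n * \<rho>) = vector [0, 0, 1 / \<rho>]"
  using assms by (simp add: lift_momentum_def angle_add_2pi_nat)

lemma lift_momentum_0: "lift_momentum \<rho> \<theta> 0 = vector [0, 0, 1 / \<rho>]"
  by (simp add: lift_momentum_def)

lemma plane_proj_lift: "plane_proj (lift \<rho> \<theta> u) = polar \<rho> \<theta> + polar \<rho> (\<theta> + u / \<rho>)"
  by (simp add: plane_proj_def lift_def polar_def vec_eq_iff forall_2 algebra_simps)

text \<open>The height is monotone in \<open>u\<close>, hence lies between its values at both
  ends.\<close>

lemma lift_in_slab:
  assumes "\<rho> > 0" "0 \<le> u" "u \<le> 2 * pi * real n * \<rho>"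
  shows "lift \<rho> \<theta> u \<in> slab (real n * pi * \<rho>\<^sup>2)"
proof -
  have "0 \<le> u / \<rho>" "u / \<rho> \<le> 2 * pi * real n"
    using assms by (simp_all add: field_simps)
  from this[THEN monoD[OF mono_add_sin]]
  have "0 \<le> u / \<rho> + sin (u / \<rho>)" "u / \<rho> + sin (u / \<rho>) \<le> 2 * pi * real n"
    using angle_add_2pi_nat(1)[of 0 n] by simp_all
  from mult_left_mono[OF this(1), of "\<rho>\<^sup>2"] mult_left_mono[OF this(2), of "\<rho>\<^sup>2"] show ?thesis
    by (simp add: slab_def lift_def algebra_simps)
qed

text \<open>The triangular wave of period \<open>2 T\<close> which is the identity on \<open>{0..T}\<close>.\<close>

definition fold_time :: "real \<Rightarrow> real \<Rightarrow> real" where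
  "fold_time T t = T / pi * arccos (cos (pi * t / T))"

lemma fold_time_bounds:
  assumes "T > 0"
  shows "0 \<le> fold_time T t" "fold_time T t \<le> T"
  using arccos_lbound[of "cos (pi * t / T)"] arccos_ubound[of "cos (pi * t / T)"] assms
  by (auto simp: fold_time_def field_simps)

lemma fold_time_periodic:
  assumes "T > 0"
  shows "fold_time T (t + 2 * of_int k * T) = fold_time T t"
proof -
  have "pi * (t + 2 * of_int k * T) / T = pi * t / T + of_int k * (2 * pi)"
    using assms by (simp add: field_simps)
  then show ?thesis
    using cos.plus_of_int[of "pi * t / T" k] by (simp add: fold_time_def)
qed

lemma fold_time_minus: "fold_time T (- t) = fold_time T t"
  by (simp add: fold_time_def)

lemma fold_time_eq:
  assumes "T > 0" "0 \<le> t" "t \<le> T"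
  shows "fold_time T t = t"
proof -
  have "arccos (cos (pi * t / T)) = pi * t / T"
    using assms by (intro arccos_cos) (simp_all add: field_simps)
  then show ?thesis
    using assms by (simp add: fold_time_def)
qed

lemma fold_time_up:
  assumes "t \<in> {2 * of_int k * T..(2 * of_int k + 1) * T}" "T > 0"
  shows "fold_time T t = t - 2 * of_int k * T"
  using fold_time_periodic[of T "t - 2 * of_int k * T" k] fold_time_eq[of T "t - 2 * of_int k * T"] assms
  by (simp add: algebra_simps)

text \<open>Falling branches are indexed by their right end point, rising ones by their left; the
  branch on \<open>{T..2 * T}\<close> has \<open>k = 1\<close>. Evenness of the wave reduces this
  case to the identity on \<open>{0..T}\<close>.\<close>

lemma fold_time_down:
  assumes "t \<in> {(2 * of_int k - 1) * T..2 * of_int k * T}" "T > 0"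
  shows "fold_time T t = 2 * of_int k * T - t"
  using fold_time_periodic[of T "t - 2 * of_int k * T" k] fold_time_eq[of T "2 * of_int k * T - t"]
    fold_time_minus[of T "2 * of_int k * T - t"] assms
  by (simp add: algebra_simps)

text \<open>The fold length is the arclength of \<open>n\<close> loops, so the curve climbs the lift
  to the top, retraces it to the bottom, and repeats this for all times.\<close>

definition folded_lift :: "real \<Rightarrow> real \<Rightarrow> nat \<Rightarrow> real \<Rightarrow> real^3" where
  "folded_lift \<rho> \<theta> n t = lift \<rho> \<theta> (fold_time (2 * pi * real n * \<rho>) t)"

lemma geodesic_momentum_folded_lift:
  fixes k :: int
  assumes "\<rho> > 0" "n \<ge> 1" and T: "T = 2 * pi * real n * \<rho>"
  shows "geodesic_momentum (folded_lift \<rho> \<theta> n) (\<lambda>t. lift_momentum \<rho> \<theta> (t - 2 * of_int k * T))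
      {2 * of_int k * T..(2 * of_int k + 1) * T}"
    and "geodesic_momentum (folded_lift \<rho> \<theta> n) (\<lambda>t. - lift_momentum \<rho> \<theta> (2 * of_int k * T - t))
      {(2 * of_int k - 1) * T..2 * of_int k * T}"
proof -
  have "T > 0" using assms by simp
  then show "geodesic_momentum (folded_lift \<rho> \<theta> n) (\<lambda>t. lift_momentum \<rho> \<theta> (t - 2 * of_int k * T))
      {2 * of_int k * T..(2 * of_int k + 1) * T}"
    using geodesic_momentum_lift[of \<rho> 1 \<theta> "2 * of_int k * T"] \<open>\<rho> > 0\<close>
    by - (rule geodesic_momentum_cong[where \<gamma> = "\<lambda>t. lift \<rho> \<theta> (t - 2 * of_int k * T)"],
      simp_all add: folded_lift_def fold_time_up[where k = k] flip: T)
  show "geodesic_momentum (folded_lift \<rho> \<theta> n) (\<lambda>t. - lift_momentum \<rho> \<theta> (2 * of_int k * T - t))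
      {(2 * of_int k - 1) * T..2 * of_int k * T}"
    using geodesic_momentum_lift[of \<rho> "-1" \<theta> "2 * of_int k * T"] \<open>\<rho> > 0\<close> \<open>T > 0\<close>
    by - (rule geodesic_momentum_cong[where \<gamma> = "\<lambda>t. lift \<rho> \<theta> (2 * of_int k * T - t)"],
      simp_all add: folded_lift_def fold_time_down[where k = k] flip: T)
qed

section \<open>The folded lift as a billiard orbit\<close>

lemma ingoing_momentumI:
  "s < t \<Longrightarrow> geodesic_momentum \<gamma> p {s..t} \<Longrightarrow> ingoing_momentum \<gamma> t (p t)"
  unfolding ingoing_momentum_def by blast

lemma outgoing_momentumI:
  "t < u \<Longrightarrow> geodesic_momentum \<gamma> p {t..u} \<Longrightarrow> outgoing_momentum \<gamma> t (p t)"
  unfolding outgoing_momentum_def by blast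

text \<open>Reflections occur at the multiples of \<open>T\<close>, the even ones at the bottom and
  the odd ones at the top.\<close>

lemma billiard_trajectory_folded_lift:
  assumes "\<rho> > 0" "n \<ge> 1" and T: "T = 2 * pi * real n * \<rho>" and H: "H = real n * pi * \<rho>\<^sup>2"
  shows "billiard_trajectory (slab H) (folded_lift \<rho> \<theta> n) (range (\<lambda>k. of_int k * T))"
proof -
  let ?\<gamma> = "folded_lift \<rho> \<theta> n" and ?B = "range (\<lambda>k. of_int k * T)"
  have "T > 0" "H > 0" using assms by simp_all
  note geo = geodesic_momentum_folded_lift[OF assms(1-3), of \<theta>]
  have "?\<gamma> t \<in> slab H" for t
    using lift_in_slab[OF \<open>\<rho> > 0\<close>] fold_time_bounds[OF \<open>T > 0\<close>] by (simp add: folded_lift_def T H)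
  moreover have "finite (?B \<inter> {s..t})" for s t
  proof (rule finite_subset)
    show "?B \<inter> {s..t} \<subseteq> (\<lambda>k. of_int k * T) ` {\<lfloor>s / T\<rfloor>..\<lceil>t / T\<rceil>}"
    proof
      fix u assume "u \<in> ?B \<inter> {s..t}"
      then obtain k :: int where k: "u = of_int k * T" "s \<le> of_int k * T" "of_int k * T \<le> t"
        by auto
      then have "s / T \<le> of_int k" "of_int k \<le> t / T"
        using \<open>T > 0\<close> by (simp_all add: field_simps)
      then have "\<lfloor>s / T\<rfloor> \<le> k" "k \<le> \<lceil>t / T\<rceil>"
        by linarith+
      with k show "u \<in> (\<lambda>k. of_int k * T) ` {\<lfloor>s / T\<rfloor>..\<lceil>t / T\<rceil>}" by auto
    qed
  qed simp
  moreover have "geodesic_on ?\<gamma> {s..t}" if "s < t" "{s<..<t} \<inter> ?B = {}" for s t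
  proof -
    \<comment> \<open>The branch on which \<open>s\<close> lies. Its right end is a reflection time,
      so an interval without inner reflections cannot pass it.\<close>
    define k where "k = \<lfloor>s / T\<rfloor>"
    have "of_int k \<le> s / T" "s / T < of_int k + 1"
      unfolding k_def by linarith+
    then have k: "of_int k * T \<le> s" "s < (of_int k + 1) * T"
      using \<open>T > 0\<close> by (simp_all add: field_simps)
    have "(of_int k + 1) * T = of_int (k + 1) * T" by simp
    then have "(of_int k + 1) * T \<in> ?B" by blast
    with that k have "t \<le> (of_int k + 1) * T"
      by (meson disjoint_iff greaterThanLessThan_iff not_le)
    with k have sub: "{s..t} \<subseteq> {of_int k * T..(of_int k + 1) * T}" by auto
    show ?thesis
    proof (cases "even k")
      case True
      then obtain j where "k = 2 * j" by (elim evenE)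
      with sub have "{s..t} \<subseteq> {2 * of_int j * T..(2 * of_int j + 1) * T}" by simp
      then show ?thesis
        using geodesic_momentum_subset[OF geo(1)] unfolding geodesic_on_def by blast
    next
      case False
      then obtain j where "k = 2 * j + 1" by (elim oddE)
      \<comment> \<open>The index is \<open>j + 1\<close> because falling branches are counted by
        their right end points.\<close>
      with sub have "{s..t} \<subseteq> {(2 * of_int (j + 1) - 1) * T..2 * of_int (j + 1) * T}"
        by (simp add: algebra_simps)
      then show ?thesis
        using geodesic_momentum_subset[OF geo(2)] unfolding geodesic_on_def by blast
    qed
  qed
  moreover have "?\<gamma> t \<in> frontier (slab H) \<and> (\<exists>l_in l_out. ingoing_momentum ?\<gamma> t l_in \<and>
      outgoing_momentum ?\<gamma> t l_out \<and> l_in \<noteq> l_out \<and>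
      l_in - l_out \<in> annihilator (boundary_tangent (slab H) (?\<gamma> t)))" if "t \<in> ?B" for t
  proof -
    let ?e = "vector [0, 0, 1 / \<rho>] :: real^3"
    from that obtain k :: int where t: "t = of_int k * T" by blast
    have height: "?\<gamma> t $ 3 = 0 \<or> ?\<gamma> t $ 3 = H"
      and momenta: "ingoing_momentum ?\<gamma> t ?e \<and> outgoing_momentum ?\<gamma> t (- ?e) \<or>
        ingoing_momentum ?\<gamma> t (- ?e) \<and> outgoing_momentum ?\<gamma> t ?e"
    proof (atomize(full), cases "even k")
      case True
      then obtain j where "k = 2 * j" by (elim evenE)
      then have t: "t = 2 * of_int j * T" using t by simp
      have "?\<gamma> t $ 3 = 0"
        using fold_time_up[of t j T] \<open>T > 0\<close>
        by (simp add: folded_lift_def t lift_0 cylindrical_def flip: T)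
      \<comment> \<open>Folding with the equation for \<open>t\<close> turns the branch parameter
        into \<open>t - t\<close>, that is 0, where the momentum is \<open>?e\<close>.\<close>
      moreover have "ingoing_momentum ?\<gamma> t (- lift_momentum \<rho> \<theta> (t - t))"
        by (rule ingoing_momentumI[OF _ geo(2)[of j, folded t]])
          (use \<open>T > 0\<close> in \<open>simp add: t\<close>)
      moreover have "outgoing_momentum ?\<gamma> t (lift_momentum \<rho> \<theta> (t - t))"
        by (rule outgoing_momentumI[OF _ geo(1)[of j, folded t]])
          (use \<open>T > 0\<close> in \<open>simp add: t\<close>)
      ultimately show "(?\<gamma> t $ 3 = 0 \<or> ?\<gamma> t $ 3 = H) \<and> (ingoing_momentum ?\<gamma> t ?e \<and>
          outgoing_momentum ?\<gamma> t (- ?e) \<or> ingoing_momentum ?\<gamma> t (- ?e) \<and> outgoing_momentum ?\<gamma> t ?e)"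
        by (simp add: lift_momentum_0)
    next
      case False
      then obtain j where "k = 2 * j + 1" by (elim oddE)
      then have t: "t = (2 * of_int j + 1) * T" using t by simp
      have eT: "lift_momentum \<rho> \<theta> T = ?e"
        using lift_momentum_loops[OF \<open>\<rho> > 0\<close>] by (simp add: T)
      have "t - 2 * of_int j * T = T" "2 * of_int (j + 1) * T - t = T"
        "t = (2 * of_int (j + 1) - 1) * T"
        by (simp_all add: t algebra_simps)
      note t' = this
      have "fold_time T t = t - 2 * of_int j * T"
        by (rule fold_time_up) (use \<open>T > 0\<close> in \<open>simp_all add: t\<close>)
      then have "?\<gamma> t = lift \<rho> \<theta> T"
        unfolding t'(1) by (simp add: folded_lift_def flip: T)
      then have "?\<gamma> t $ 3 = H"
        using lift_loops[OF \<open>\<rho> > 0\<close>, of \<theta> n] by (simp add: T H cylindrical_def)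
      moreover have "ingoing_momentum ?\<gamma> t (lift_momentum \<rho> \<theta> (t - 2 * of_int j * T))"
        by (rule ingoing_momentumI[OF _ geo(1)[of j, folded t]])
          (use \<open>T > 0\<close> in \<open>simp add: t\<close>)
      moreover have "outgoing_momentum ?\<gamma> t (- lift_momentum \<rho> \<theta> (2 * of_int (j + 1) * T - t))"
        by (rule outgoing_momentumI[OF _ geo(2)[of "j + 1", folded t'(3)]])
          (use \<open>T > 0\<close> in \<open>simp add: t\<close>)
      ultimately show "(?\<gamma> t $ 3 = 0 \<or> ?\<gamma> t $ 3 = H) \<and> (ingoing_momentum ?\<gamma> t ?e \<and>
          outgoing_momentum ?\<gamma> t (- ?e) \<or> ingoing_momentum ?\<gamma> t (- ?e) \<and> outgoing_momentum ?\<gamma> t ?e)"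
        unfolding t'(1,2) eT by blast
    qed
    have "?e \<noteq> - ?e" "- ?e \<noteq> ?e"
      using \<open>\<rho> > 0\<close> by (auto simp: vec_eq_iff forall_3)
    moreover have "?e - - ?e \<in> annihilator (boundary_tangent (slab H) (?\<gamma> t))"
        "- ?e - ?e \<in> annihilator (boundary_tangent (slab H) (?\<gamma> t))"
      by (rule vertical_in_annihilator_slab[OF \<open>H > 0\<close> height]; simp)+
    moreover have "?\<gamma> t \<in> frontier (slab H)"
      using height by (simp add: frontier_slab[OF \<open>H > 0\<close>])
    ultimately show ?thesis using momenta by blast
  qed
  ultimately show ?thesis
    unfolding billiard_trajectory_def by blast
qed

lemma circle_orbit_folded_lift:
  assumes "\<rho> > 0" "n \<ge> 1" and H: "H = real n * pi * \<rho>\<^sup>2"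
  shows "circle_orbit H n (2 * \<rho>) \<theta> (folded_lift \<rho> \<theta> n)"
proof -
  define T where T: "T = 2 * pi * real n * \<rho>"
  let ?\<gamma> = "folded_lift \<rho> \<theta> n" and ?B = "range (\<lambda>k. of_int k * T)"
  have "T > 0" using assms by (simp add: T)
  note geo = geodesic_momentum_folded_lift[OF assms(1,2) T, of \<theta>]
  have up: "?\<gamma> t = lift \<rho> \<theta> t" if "t \<in> {0..T}" for t
    using fold_time_up[of t 0 T] \<open>T > 0\<close> that by (simp add: folded_lift_def flip: T)
  \<comment> \<open>The reflections in the period starting at 0 are at 0 and \<open>T\<close>; the
    second segment is the falling branch with index 1.\<close>
  have down: "?\<gamma> t = lift \<rho> \<theta> (2 * T - t)" if "t \<in> {T..2 * T}" for t
    using fold_time_down[of t 1 T] \<open>T > 0\<close> that by (simp add: folded_lift_def flip: T)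
  have periodic: "t + 2 * T \<in> ?B \<longleftrightarrow> t \<in> ?B" for t
  proof -
    have "t + 2 * T = of_int (k + 2) * T \<longleftrightarrow> t = of_int k * T" for k :: int
      by (simp add: algebra_simps)
    then show ?thesis
      by (metis (no_types, lifting) diff_add_cancel rangeE rangeI)
  qed
  have B: "?B \<inter> {0..<0 + 2 * T} = {0, T}"
  proof -
    have "k = 0 \<or> k = 1" if "0 \<le> of_int k * T" "of_int k * T < 2 * T" for k :: int
    proof -
      have "0 \<le> k" "k < 2"
        using that \<open>T > 0\<close> by (simp_all add: zero_le_mult_iff)
      then show ?thesis by linarith
    qed
    then have "?B \<inter> {0..<0 + 2 * T} \<subseteq> {0, T}"
      by fastforce
    moreover have "0 \<in> ?B" "T \<in> ?B"
      by (auto intro: range_eqI[of _ _ 0] range_eqI[of _ _ 1])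
    ultimately show ?thesis
      using \<open>T > 0\<close> by auto
  qed
  have "two_bounce_orbit (slab H) ?\<gamma> (2 * T) 0 T"
    unfolding two_bounce_orbit_def
  proof (intro conjI exI)
    show "\<forall>t. ?\<gamma> (t + 2 * T) = ?\<gamma> t"
      using fold_time_periodic[OF \<open>T > 0\<close>, of _ 1] by (simp add: folded_lift_def flip: T)
    show "billiard_trajectory (slab H) ?\<gamma> ?B"
      using billiard_trajectory_folded_lift[OF assms(1,2) T H] .
    show "\<forall>t. t + 2 * T \<in> ?B \<longleftrightarrow> t \<in> ?B" "?B \<inter> {0..<0 + 2 * T} = {0, T}"
      using periodic B by blast+
  qed (use \<open>T > 0\<close> in auto)
  moreover have "?\<gamma> 0 = cylindrical (2 * \<rho>) \<theta> 0"
    using up[of 0] \<open>T > 0\<close> by (simp add: lift_0)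
  moreover have "?\<gamma> T = cylindrical (2 * \<rho>) \<theta> H"
    using up[of T] \<open>T > 0\<close> lift_loops[OF \<open>\<rho> > 0\<close>] by (simp add: T H)
  moreover have "reversed_segments ?\<gamma> 0 T T (0 + 2 * T)"
    using up down by (simp add: reversed_segments_def)
  \<comment> \<open>The planar curve is taken to be the projection of the orbit itself.\<close>
  moreover have "lifts_on ?\<gamma> (\<lambda>t. plane_proj (?\<gamma> t)) {0..T}"
      "lifts_on ?\<gamma> (\<lambda>t. plane_proj (?\<gamma> t)) {T..0 + 2 * T}"
    using geodesic_momentum_lifts_on[OF geo(1)[of 0]] geodesic_momentum_lifts_on[OF geo(2)[of 1]]
    by simp_all
  moreover have "loops_along_circle n (polar \<rho> \<theta>) \<rho> (\<lambda>t. plane_proj (?\<gamma> t)) 0 T"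
    unfolding loops_along_circle_def
  proof (intro exI conjI disjI1)
    \<comment> \<open>The angle is read off from \<open>plane_proj_lift\<close>; over a time
      \<open>T\<close> it changes by \<open>T / \<rho>\<close>, which is \<open>n\<close> full
      turns.\<close>
    show "continuous_on {0..T} (\<lambda>u. \<theta> + u / \<rho>)"
      using \<open>\<rho> > 0\<close> by (intro continuous_intros) auto
    show "strict_mono_on {0..T} (\<lambda>u. \<theta> + u / \<rho>)"
      using \<open>\<rho> > 0\<close> by (simp add: monotone_on_def divide_strict_right_mono)
  qed (use \<open>\<rho> > 0\<close> up in \<open>auto simp: T plane_proj_lift\<close>)
  moreover have "loops_along_circle n (polar \<rho> \<theta>) \<rho> (\<lambda>t. plane_proj (?\<gamma> t)) T (0 + 2 * T)"
    unfolding loops_along_circle_def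
  proof (intro exI conjI disjI2)
    show "continuous_on {T..0 + 2 * T} (\<lambda>u. \<theta> + (2 * T - u) / \<rho>)"
      using \<open>\<rho> > 0\<close> by (intro continuous_intros) auto
    show "strict_antimono_on {T..0 + 2 * T} (\<lambda>u. \<theta> + (2 * T - u) / \<rho>)"
      using \<open>\<rho> > 0\<close> by (simp add: monotone_on_def divide_strict_right_mono)
  qed (use \<open>\<rho> > 0\<close> down in \<open>auto simp: T plane_proj_lift\<close>)
  ultimately show ?thesis
    unfolding circle_orbit_def by (intro exI[of _ "2 * T"] exI[of _ 0] exI[of _ T]) auto
qed

section \<open>Uniqueness up to a shift of time\<close>

text \<open>The first segment is fixed by rigidity and by the height of its end point, the second by
  reversal, and all other times by periodicity.\<close>

lemma circle_orbit_eq_folded_lift: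
  assumes "\<rho> > 0" "n \<ge> 1" and H: "H = real n * pi * \<rho>\<^sup>2"
    and "circle_orbit H n (2 * \<rho>) \<theta> \<gamma>"
  shows "\<exists>s. \<forall>t. \<gamma> t = folded_lift \<rho> \<theta> n (t + s)"
proof -
  define T where T: "T = 2 * pi * real n * \<rho>"
  have "T > 0" using assms by (simp add: T)
  from assms(4) obtain \<tau> t1 t2 c where orbit: "two_bounce_orbit (slab H) \<gamma> \<tau> t1 t2"
    and start: "\<gamma> t1 = cylindrical (2 * \<rho>) \<theta> 0" and top: "\<gamma> t2 = cylindrical (2 * \<rho>) \<theta> H"
    and rev: "reversed_segments \<gamma> t1 t2 t2 (t1 + \<tau>)"
    and loops: "loops_along_circle n (polar \<rho> \<theta>) \<rho> c t1 t2" and lifts: "lifts_on \<gamma> c {t1..t2}"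
    unfolding circle_orbit_def by auto
  from orbit obtain B where "t1 < t2" "t2 < t1 + \<tau>" and periodic: "\<And>t. \<gamma> (t + \<tau>) = \<gamma> t"
    and billiard: "billiard_trajectory (slab H) \<gamma> B" and B: "B \<inter> {t1..<t1 + \<tau>} = {t1, t2}"
    unfolding two_bounce_orbit_def by blast
  have "{t1<..<t2} \<inter> B = {}"
  proof -
    have "{t1<..<t2} \<inter> B \<subseteq> {t1<..<t2} \<inter> (B \<inter> {t1..<t1 + \<tau>})"
      using \<open>t2 < t1 + \<tau>\<close> by auto
    then show ?thesis unfolding B by auto
  qed
  with billiard \<open>t1 < t2\<close> have geo: "geodesic_on \<gamma> {t1..t2}"
    unfolding billiard_trajectory_def by blast
  have "(\<gamma> u $ 1 - \<rho> * cos \<theta>)\<^sup>2 + (\<gamma> u $ 2 - \<rho> * sin \<theta>)\<^sup>2 = \<rho>\<^sup>2" if "u \<in> {t1..t2}" for u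
  proof -
    from loops obtain \<phi> where "\<forall>u\<in>{t1..t2}. c u = polar \<rho> \<theta> + polar \<rho> (\<phi> u)"
      unfolding loops_along_circle_def by blast
    with lifts that have "plane_proj (\<gamma> u) = polar \<rho> \<theta> + polar \<rho> (\<phi> u)"
      unfolding lifts_on_def by auto
    then have "\<gamma> u $ 1 - \<rho> * cos \<theta> = \<rho> * cos (\<phi> u)" "\<gamma> u $ 2 - \<rho> * sin \<theta> = \<rho> * sin (\<phi> u)"
      by (simp_all add: plane_proj_def polar_def vec_eq_iff forall_2)
    then show ?thesis
      by (simp add: power_mult_distrib flip: distrib_left)
  qed
  from geodesic_on_circle_eq_lift[OF geo \<open>t1 < t2\<close> \<open>\<rho> > 0\<close> this start]
  obtain \<sigma> where \<sigma>: "\<sigma> = 1 \<or> \<sigma> = -1"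
    and lift: "\<And>u. u \<in> {t1..t2} \<Longrightarrow> \<gamma> u = lift \<rho> \<theta> (\<sigma> * (u - t1))"
    by blast
  \<comment> \<open>The signed angle turned between the two reflections.\<close>
  define w where "w = \<sigma> * (t2 - t1) / \<rho>"
  have "\<rho>\<^sup>2 * (w + sin w) / 2 = H"
    using lift[of t2] top \<open>t1 < t2\<close> by (simp add: lift_def cylindrical_def vec_eq_iff forall_3 w_def)
  then have "\<rho>\<^sup>2 * (w + sin w) = 2 * H"
    by simp
  also have "\<dots> = \<rho>\<^sup>2 * (2 * pi * real n)"
    by (simp add: H)
  finally have "w + sin w = 2 * pi * real n"
    using \<open>\<rho> > 0\<close> by simp
  then have "w = 2 * pi * real n"
    by (simp only: add_sin_eq_iff)
  then have "\<sigma> * (t2 - t1) = T"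
    using \<open>\<rho> > 0\<close> by (simp add: w_def T field_simps)
  \<comment> \<open>The clockwise lift is excluded, as it would give the positive \<open>T\<close> a
    negative value.\<close>
  with \<sigma> \<open>T > 0\<close> \<open>t1 < t2\<close> have "\<sigma> = 1" and t2: "t2 = t1 + T"
    by auto
  \<comment> \<open>Reversed segments have equal duration, and together they fill the
    period.\<close>
  have \<tau>: "\<tau> = 2 * T" and mirror: "\<And>u. u \<in> {0..T} \<Longrightarrow> \<gamma> (t2 + u) = \<gamma> (t2 - u)"
    using rev unfolding reversed_segments_def t2 by auto
  have period: "\<gamma> (t1 + u) = folded_lift \<rho> \<theta> n u" if "0 \<le> u" "u < 2 * T" for u
  proof (cases "u \<le> T")
    case True
    then show ?thesis
      using fold_time_up[of u 0 T] lift[of "t1 + u"] that \<open>T > 0\<close> \<open>\<sigma> = 1\<close> t2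
      by (simp add: folded_lift_def flip: T)
  next
    case False
    \<comment> \<open>Mirroring at \<open>t2 = t1 + T\<close> exchanges \<open>t1 + u\<close> and
      \<open>t1 + (2 * T - u)\<close>.\<close>
    then have "\<gamma> (t1 + u) = \<gamma> (t1 + (2 * T - u))"
      using mirror[of "u - T"] that by (simp add: t2 algebra_simps)
    also have "\<dots> = lift \<rho> \<theta> (2 * T - u)"
      using lift[of "t1 + (2 * T - u)"] that False \<open>\<sigma> = 1\<close> t2 by simp
    also have "\<dots> = folded_lift \<rho> \<theta> n u"
      using fold_time_down[of u 1 T] that False \<open>T > 0\<close> by (simp add: folded_lift_def flip: T)
    finally show ?thesis .
  qed
  interpret periodic_fun_simple \<gamma> "2 * T"
    by standard (use periodic in \<open>simp add: \<tau>\<close>)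
  have "\<gamma> t = folded_lift \<rho> \<theta> n (t + - t1)" for t
  proof -
    \<comment> \<open>Number of whole periods since \<open>t1\<close>; \<open>u\<close> is the
      remainder, to which \<open>period\<close> applies.\<close>
    define k where "k = \<lfloor>(t - t1) / (2 * T)\<rfloor>"
    define u where "u = t - t1 - of_int k * (2 * T)"
    have "of_int k \<le> (t - t1) / (2 * T)" "(t - t1) / (2 * T) < of_int k + 1"
      unfolding k_def by linarith+
    then have "0 \<le> u" "u < 2 * T"
      using \<open>T > 0\<close> by (simp_all add: u_def field_simps)
    have "\<gamma> (t1 + u + of_int k * (2 * T)) = \<gamma> (t1 + u)"
      by (rule plus_of_int)
    moreover have "folded_lift \<rho> \<theta> n (u + 2 * of_int k * T) = folded_lift \<rho> \<theta> n u"
      using fold_time_periodic[OF \<open>T > 0\<close>] by (simp add: folded_lift_def flip: T)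
    ultimately show ?thesis
      using period[OF \<open>0 \<le> u\<close> \<open>u < 2 * T\<close>] by (simp add: u_def algebra_simps)
  qed
  then show ?thesis by blast
qed

theorem lemma5p32:
  fixes H r0 \<theta>0 :: real and n :: nat
  assumes "H > 0" and "n \<ge> 1"
    and "r0 = 2 * sqrt (H / (pi * real n))"
  shows "\<exists>\<gamma>. circle_orbit H n r0 \<theta>0 \<gamma> \<and>
           (\<forall>\<gamma>'. circle_orbit H n r0 \<theta>0 \<gamma>' \<longrightarrow> (\<exists>s. \<forall>t. \<gamma>' t = \<gamma> (t + s)))"
proof -
  \<comment> \<open>The radius of the planar circle, for which \<open>n\<close> loops enclose total
    area \<open>H\<close>.\<close>
  define \<rho> where "\<rho> = sqrt (H / (pi * real n))"
  have "\<rho> > 0" "H = real n * pi * \<rho>\<^sup>2" "r0 = 2 * \<rho>"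
    using assms by (simp_all add: \<rho>_def)
  then show ?thesis
    using circle_orbit_folded_lift circle_orbit_eq_folded_lift \<open>n \<ge> 1\<close> by blast
qed

end
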